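(* Let $n\ge 2$. A map $\diamondsuit:\mathcal{K}^n\to\mathcal{K}^n_s$ (an $o$-symmetrization) is projection covariant if and only if it is continuous and $GL(n)$ covariant (and hence homogeneous of degree $1$).
   Context: $\mathcal{K}^n$ is the class of nonempty compact convex subsets of $\mathbb{R}^n$; $\mathcal{K}^n_s$ is the subclass of sets with $K=-K$. Properties of $\diamondsuit$ (for all $K,K_m\in\mathcal{K}^n$): projection covariant: $(\diamondsuit K)|S=\diamondsuit(K|S)$ for every linear subspace $S$ of $\mathbb{R}^n$ of dimension $k$, $1\le k\le n-1$, where $X|S$ is the orthogonal projection of $X$ onto $S$ (as a subset of $\mathbb{R}^n$); continuous: $K_m\to K$ in the Hausdorff metric implies $\diamondsuit K_m\to\diamondsuit K$ in the Hausdorff metric; $GL(n)$ covariant: $\phi(\diamondsuit K)=\diamondsuit(\phi K)$ for all $\phi\in GL(n)$; homogeneous of degree $1$: $\diamondsuit(rK)=r\diamondsuit K$ for all $r\ge0$. *)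

theory Defs
  imports "HOL-Analysis.Analysis"
begin

definition convex_bodies :: "(real^'n) set set" where
  "convex_bodies = {K. K \<noteq> {} \<and> compact K \<and> convex K}"

definition symmetric_convex_bodies :: "(real^'n) set set" where
  "symmetric_convex_bodies = {K \<in> convex_bodies. K = uminus ` K}"

(* Only meaningful for nonempty bounded sets; infdist and SUP take default values otherwise. *)
definition hausdorff_dist :: "'a::metric_space set \<Rightarrow> 'a set \<Rightarrow> real" where
  "hausdorff_dist K L = max (SUP x\<in>K. infdist x L) (SUP y\<in>L. infdist y K)"

(* The set K|S of the orthogonal projections of the points of K onto the subspace S:
   y is the projection of x iff y lies in S and x - y is orthogonal to S. *)
definition orth_proj_image :: "(real^'n) set \<Rightarrow> (real^'n) set \<Rightarrow> (real^'n) set" where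
  "orth_proj_image K S = {y \<in> S. \<exists>x\<in>K. x - y \<in> orthogonal_comp S}"

(* An operation on convex bodies is a total function on sets, of which only the values on
   convex_bodies matter: each property below quantifies over convex_bodies only. *)

definition projection_covariant :: "((real^'n) set \<Rightarrow> (real^'n) set) \<Rightarrow> bool" where
  "projection_covariant D \<longleftrightarrow>
     (\<forall>K\<in>convex_bodies. \<forall>S. subspace S \<and> 1 \<le> dim S \<and> dim S \<le> CARD('n) - 1 \<longrightarrow>
        orth_proj_image (D K) S = D (orth_proj_image K S))"

definition hausdorff_continuous :: "((real^'n) set \<Rightarrow> (real^'n) set) \<Rightarrow> bool" where
  "hausdorff_continuous D \<longleftrightarrow>
     (\<forall>K\<in>convex_bodies. \<forall>L. (\<forall>m::nat. L m \<in> convex_bodies) \<and>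
        (\<lambda>m. hausdorff_dist (L m) K) \<longlonglongrightarrow> 0 \<longrightarrow>
        (\<lambda>m. hausdorff_dist (D (L m)) (D K)) \<longlonglongrightarrow> 0)"

definition GL_covariant :: "((real^'n) set \<Rightarrow> (real^'n) set) \<Rightarrow> bool" where
  "GL_covariant D \<longleftrightarrow>
     (\<forall>K\<in>convex_bodies. \<forall>A::real^'n^'n. invertible A \<longrightarrow>
        (\<lambda>x. A *v x) ` D K = D ((\<lambda>x. A *v x) ` K))"

definition homogeneous_deg1 :: "((real^'n) set \<Rightarrow> (real^'n) set) \<Rightarrow> bool" where
  "homogeneous_deg1 D \<longleftrightarrow>
     (\<forall>K\<in>convex_bodies. \<forall>r\<ge>0. D ((\<lambda>x. r *\<^sub>R x) ` K) = (\<lambda>x. r *\<^sub>R x) ` D K)"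

end

theory Submission
  imports Defs
begin

text \<open>
  For a projection covariant \<open>D\<close>, projecting onto lines shows that the image of \<open>D K\<close> under the
  functional \<open>inner v\<close> depends only on the interval \<open>inner v ` K\<close>. It does not depend on \<open>v\<close> either:
  for independent \<open>v, w\<close> choose \<open>x\<close> with \<open>v \<bullet> x = w \<bullet> x = 1\<close> and compare the two functionals on a
  segment along \<open>x\<close>, which \<open>D\<close> maps into the line of \<open>x\<close>. Since \<open>inner v ` (A ` K)\<close> equals
  \<open>inner (transpose A *v v) ` K\<close>, this gives covariance under \<open>GL(n)\<close>. Moreover every interval
  \<open>{s..t}\<close> is the image of the segment \<open>Q\<close> joining two orthonormal vectors \<open>a, b\<close> under \<open>inner (s a + t b)\<close>,
  so all values of \<open>D\<close> are encoded in the single body \<open>D Q\<close>, and \<open>D\<close> is Lipschitz with a constant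
  given by the size of \<open>D Q\<close>. Conversely, an orthogonal projection is a limit of invertible maps.
\<close>

section \<open>Hausdorff distance of compact sets\<close>

lemma hausdorff_dist_leI:
  assumes "K \<noteq> {}" "L \<noteq> {}"
    and "\<And>x. x \<in> K \<Longrightarrow> infdist x L \<le> e" "\<And>y. y \<in> L \<Longrightarrow> infdist y K \<le> e"
  shows "hausdorff_dist K L \<le> e"
  unfolding hausdorff_dist_def using assms by (auto intro!: cSUP_least)

lemma bdd_above_infdist_image:
  assumes "compact K"
  shows "bdd_above ((\<lambda>x. infdist x L) ` K)"
  by (intro bounded_imp_bdd_above compact_imp_bounded compact_continuous_image assms
      continuous_intros)

lemma infdist_le_hausdorff_dist:
  assumes "compact K" "x \<in> K"
  shows "infdist x L \<le> hausdorff_dist K L"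
  unfolding hausdorff_dist_def
  using cSUP_upper[OF assms(2) bdd_above_infdist_image[OF assms(1), of L]] by simp

lemma hausdorff_dist_commute: "hausdorff_dist K L = hausdorff_dist L K"
  by (simp add: hausdorff_dist_def max.commute)

lemma hausdorff_dist_nonneg:
  assumes "compact K" "K \<noteq> {}"
  shows "0 \<le> hausdorff_dist K L"
  using assms infdist_le_hausdorff_dist infdist_nonneg order_trans by (metis ex_in_conv)

lemma hausdorff_dist_witness:
  fixes K L :: "'a::heine_borel set"
  assumes "compact K" "compact L" "L \<noteq> {}" "x \<in> K"
  obtains y where "y \<in> L" "dist x y \<le> hausdorff_dist K L"
proof -
  obtain y where "y \<in> L" "infdist x L = dist x y"
    using infdist_attains_inf[of L x] assms compact_imp_closed by blast
  then show thesis
    using that infdist_le_hausdorff_dist[OF assms(1,4), of L] by auto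
qed

text \<open>One half of the uniqueness of limits: passing through a point of \<open>X m\<close>
  bounds \<open>infdist y Z\<close> by a sum of two distances tending to 0, and \<open>Z\<close> is
  closed.\<close>

lemma hausdorff_limit_subset:
  fixes Y Z :: "'a::heine_borel set"
  assumes X: "\<And>m. compact (X m)" "\<And>m. X m \<noteq> {}"
    and Y: "compact Y" and Z: "compact Z" "Z \<noteq> {}"
    and "(\<lambda>m. hausdorff_dist (X m) Y) \<longlonglongrightarrow> 0" "(\<lambda>m. hausdorff_dist (X m) Z) \<longlonglongrightarrow> 0"
  shows "Y \<subseteq> Z"
proof
  fix y assume y: "y \<in> Y"
  have "infdist y Z \<le> hausdorff_dist (X m) Y + hausdorff_dist (X m) Z" for m
  proof -
    obtain x where x: "x \<in> X m" "dist y x \<le> hausdorff_dist (X m) Y"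
      using hausdorff_dist_witness[OF Y X(1,2) y] by (metis hausdorff_dist_commute)
    obtain z where z: "z \<in> Z" "dist x z \<le> hausdorff_dist (X m) Z"
      using hausdorff_dist_witness[OF X(1) Z x(1)] .
    have "infdist y Z \<le> dist y z" using z(1) by (rule infdist_le)
    also have "\<dots> \<le> dist y x + dist x z" by (rule dist_triangle)
    finally show ?thesis using x(2) z(2) by linarith
  qed
  moreover have "(\<lambda>m. hausdorff_dist (X m) Y + hausdorff_dist (X m) Z) \<longlonglongrightarrow> 0"
    using tendsto_add[OF assms(6,7)] by simp
  ultimately have "infdist y Z \<le> 0"
    by (meson LIMSEQ_le_const)
  then have "infdist y Z = 0"
    using infdist_nonneg[of y Z] by linarith
  then show "y \<in> Z"
    using in_closed_iff_infdist_zero[OF compact_imp_closed[OF Z(1)] Z(2)] by blast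
qed

lemma hausdorff_limit_unique:
  fixes Y Z :: "'a::heine_borel set"
  assumes "\<And>m. compact (X m)" "\<And>m. X m \<noteq> {}"
    and "compact Y" "Y \<noteq> {}" "compact Z" "Z \<noteq> {}"
    and "(\<lambda>m. hausdorff_dist (X m) Y) \<longlonglongrightarrow> 0" "(\<lambda>m. hausdorff_dist (X m) Z) \<longlonglongrightarrow> 0"
  shows "Y = Z"
  using hausdorff_limit_subset[of X Y Z] hausdorff_limit_subset[of X Z Y] assms by blast

lemma hausdorff_dist_image_le:
  assumes "K \<noteq> {}" "\<And>x. x \<in> K \<Longrightarrow> dist (f x) (g x) \<le> e"
  shows "hausdorff_dist (f ` K) (g ` K) \<le> e"
  using assms
  by (intro hausdorff_dist_leI) (auto intro: infdist_le2 simp: dist_commute)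

text \<open>Only one direction matters: the unit vector \<open>v\<close> from the closest point
  \<open>y\<close> of \<open>L\<close> towards \<open>x\<close>. The hyperplane through
  \<open>y\<close> orthogonal to \<open>v\<close> supports \<open>L\<close>, so no \<open>z\<close>
  in \<open>L\<close> exceeds \<open>y\<close> in this direction, while
  \<open>v \<bullet> (x - y)\<close> is the distance. Bound 0 gives separation; a general bound
  serves the Lipschitz estimate.\<close>

lemma infdist_le_if_widths_le:
  fixes x :: "'a::euclidean_space"
  assumes L: "convex L" "closed L" "L \<noteq> {}"
    and le: "\<And>v. norm v = 1 \<Longrightarrow> \<exists>z\<in>L. v \<bullet> x \<le> v \<bullet> z + e" and "0 \<le> e"
  shows "infdist x L \<le> e"
proof (cases "x \<in> L")
  case True
  then show ?thesis using \<open>0 \<le> e\<close> by simp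
next
  case False
  define y where "y = closest_point L x"
  have y: "y \<in> L" unfolding y_def using L closest_point_in_set by blast
  define v where "v = (x - y) /\<^sub>R norm (x - y)"
  have "x \<noteq> y" using False y by auto
  then have "norm v = 1" by (simp add: v_def)
  with le obtain z where z: "z \<in> L" "v \<bullet> x \<le> v \<bullet> z + e" by blast
  have "(x - y) \<bullet> (z - y) \<le> 0"
    unfolding y_def using closest_point_dot[OF L(1,2) z(1)] .
  then have "v \<bullet> (z - y) \<le> 0"
    by (simp add: v_def divide_simps mult_le_0_iff)
  then have "v \<bullet> (x - y) \<le> e"
    using z(2) by (simp add: inner_diff_right)
  moreover have "v \<bullet> (x - y) = norm (x - y)"
    using \<open>x \<noteq> y\<close> by (simp add: v_def flip: power2_norm_eq_inner) (simp add: power2_eq_square)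
  ultimately show ?thesis
    using infdist_le[OF y, of x] by (simp add: dist_norm)
qed

section \<open>Convex bodies and orthogonal projections\<close>

lemma convex_bodiesD:
  assumes "K \<in> convex_bodies"
  shows "K \<noteq> {}" "compact K" "convex K"
  using assms by (auto simp: convex_bodies_def)

lemma linear_image_convex_bodies:
  fixes f :: "real^'n \<Rightarrow> real^'m"
  assumes "linear f" "K \<in> convex_bodies"
  shows "f ` K \<in> convex_bodies"
  using assms
  by (auto simp: convex_bodies_def linear_linear linear_continuous_on
      intro!: compact_continuous_image convex_linear_image)

lemma segment_convex_bodies:
  assumes "s \<le> t"
  shows "(\<lambda>r. r *\<^sub>R x) ` {s..t} \<in> (convex_bodies :: (real^'n) set set)"
  unfolding convex_bodies_def using assms
  by (auto intro!: compact_continuous_image continuous_intros convex_linear_image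
      bounded_linear.linear[OF bounded_linear_scaleR_left])

lemma inner_image_interval:
  assumes "K \<in> convex_bodies"
  obtains s t where "s \<le> t" "inner v ` K = {s..t}"
proof -
  have cont: "continuous_on K (inner v)" by (intro continuous_intros)
  have "connected (inner v ` K)"
    using connected_continuous_image[OF cont convex_connected] convex_bodiesD(3)[OF assms] .
  moreover have "compact (inner v ` K)"
    using compact_continuous_image[OF cont] convex_bodiesD(2)[OF assms] .
  ultimately obtain s t where st: "inner v ` K = {s..t}"
    using connected_compact_interval_1[of "inner v ` K"] by auto
  moreover have "{s..t} \<noteq> {}"
    unfolding st[symmetric] using convex_bodiesD(1)[OF assms] by simp
  then have "s \<le> t" by simp
  ultimately show thesis by (rule that[rotated])
qed

text \<open>A point outside a closed convex set is separated from it by some functional; this is the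
  preceding criterion with bound 0, used in both directions.\<close>

lemma convex_bodies_eqI:
  fixes K L :: "(real^'n) set"
  assumes K: "K \<in> convex_bodies" and L: "L \<in> convex_bodies"
    and eq: "\<And>v. inner v ` K = inner v ` L"
  shows "K = L"
proof -
  have sub: "K \<subseteq> L" if "K \<in> convex_bodies" "L \<in> convex_bodies" "\<And>v. inner v ` K = inner v ` L"
    for K L :: "(real^'n) set"
  proof
    fix x assume x: "x \<in> K"
    have L: "closed L" "L \<noteq> {}" "convex L"
      using convex_bodiesD[OF that(2)] compact_imp_closed by auto
    have "infdist x L \<le> 0"
    proof (rule infdist_le_if_widths_le)
      fix v :: "real^'n"
      have "v \<bullet> x \<in> inner v ` L" using that(3) x by blast
      then show "\<exists>z\<in>L. v \<bullet> x \<le> v \<bullet> z + 0" by auto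
    qed (use L in auto)
    then show "x \<in> L"
      using in_closed_iff_infdist_zero[OF L(1,2)] infdist_nonneg[of x L] by fastforce
  qed
  show ?thesis using sub[OF K L eq] sub[OF L K eq[symmetric]] by blast
qed

section \<open>Orthogonal projection onto a subspace as a linear map\<close>

lemma orthogonal_projection_exists:
  fixes S :: "(real^'n) set"
  assumes "subspace S"
  obtains p where "linear p" "\<And>x. p x \<in> S" "\<And>x. x - p x \<in> orthogonal_comp S"
proof -
  obtain B where B: "B \<subseteq> S" "pairwise orthogonal B" "span B = S" "independent B"
    using orthonormal_basis_subspace[OF assms] by metis
  \<comment> \<open>Expansion in an orthogonal basis; unit length of the vectors of \<open>B\<close>
    is not recorded, hence the division by \<open>b \<bullet> b\<close>.\<close>
  define p where "p x = (\<Sum>b\<in>B. (b \<bullet> x / (b \<bullet> b)) *\<^sub>R b)" for x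
  show thesis
  proof
    show "linear p"
      unfolding p_def
      by (intro linear_compose_sum ballI linearI)
         (simp_all add: inner_add_right add_divide_distrib scaleR_left_distrib)
    show "p x \<in> S" for x
      unfolding p_def using B assms by (intro subspace_sum subspace_mul) auto
    show "x - p x \<in> orthogonal_comp S" for x
      using Gram_Schmidt_step[OF B(2)] B(3) by (auto simp: p_def orthogonal_comp_def)
  qed
qed

lemma subspace_Int_orthogonal_comp:
  assumes "subspace S" "x \<in> S" "x \<in> orthogonal_comp S"
  shows "x = 0"
  using assms by (auto simp: orthogonal_comp_def orthogonal_self)

text \<open>Two candidates for the projection of one point differ by a vector lying both in
  \<open>S\<close> and in its orthogonal complement, hence by 0.\<close>

lemma orth_proj_image_eq:
  fixes S :: "(real^'n) set"
  assumes S: "subspace S" and p: "\<And>x. p x \<in> S" "\<And>x. x - p x \<in> orthogonal_comp S"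
  shows "orth_proj_image K S = p ` K"
proof -
  have "y = p x" if "y \<in> S" "x - y \<in> orthogonal_comp S" for x y
  proof -
    have "(x - y) - (x - p x) \<in> orthogonal_comp S"
      by (intro subspace_diff subspace_orthogonal_comp that p)
    moreover have "p x - y \<in> S" by (intro subspace_diff S that p)
    ultimately show ?thesis
      using subspace_Int_orthogonal_comp[OF S, of "p x - y"] by simp
  qed
  then show ?thesis
    unfolding orth_proj_image_def using p by blast
qed

text \<open>Translates projections onto lines into functionals: for fixed \<open>v\<close>, the
  projection of \<open>K\<close> and the image of \<open>K\<close> under \<open>inner v\<close>
  determine each other.\<close>

lemma orth_proj_image_span:
  fixes v :: "real^'n"
  assumes "v \<noteq> 0"
  shows "orth_proj_image K (span {v}) = (\<lambda>r. (r / (v \<bullet> v)) *\<^sub>R v) ` inner v ` K"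
proof -
  have "orth_proj_image K (span {v}) = (\<lambda>x. (v \<bullet> x / (v \<bullet> v)) *\<^sub>R v) ` K"
    using assms
    by (intro orth_proj_image_eq subspace_span)
       (auto simp: span_singleton orthogonal_comp_def orthogonal_def inner_diff_right inner_commute)
  then show ?thesis by (simp add: image_image)
qed

section \<open>Continuity and linear covariance imply projection covariance\<close>

lemma GL_covariant_injective:
  assumes "GL_covariant D" "K \<in> convex_bodies" "linear f" "inj f"
  shows "f ` D K = D (f ` K)"
proof -
  have "invertible (matrix f)"
    using assms(3,4) matrix_left_invertible_injective[of "matrix f"]
    by (simp add: invertible_left_inverse matrix_works)
  then show ?thesis
    using assms(1,2) matrix_vector_mul(2)[OF assms(3)] unfolding GL_covariant_def by metis
qed

lemma hausdorff_continuousD: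
  assumes "hausdorff_continuous D" "K \<in> convex_bodies" "\<And>m. L m \<in> convex_bodies"
    and "(\<lambda>m. hausdorff_dist (L m) K) \<longlonglongrightarrow> 0"
  shows "(\<lambda>m. hausdorff_dist (D (L m)) (D K)) \<longlonglongrightarrow> 0"
  using assms(1)[unfolded hausdorff_continuous_def, rule_format, OF assms(2), of L] assms(3,4) by simp

text \<open>Extends covariance to a possibly singular \<open>f\<close>: the maps \<open>h m\<close>
  are invertible perturbations of \<open>f\<close>, and the images of \<open>D K\<close> under them
  converge both to its image under \<open>f\<close> and, by continuity of \<open>D\<close>, to
  \<open>D\<close> of the image of \<open>K\<close> under \<open>f\<close>.\<close>

lemma covariant_limit:
  fixes f g :: "real^'n \<Rightarrow> real^'n"
  assumes D: "D \<in> convex_bodies \<rightarrow> convex_bodies"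
    and cov: "hausdorff_continuous D" "GL_covariant D" and K: "K \<in> convex_bodies"
    and lin: "linear f" "linear g" and inj: "\<And>c. 0 < c \<Longrightarrow> inj (\<lambda>x. f x + c *\<^sub>R g x)"
  shows "f ` D K = D (f ` K)"
proof -
  define h where "h m x = f x + inverse (Suc m) *\<^sub>R g x" for m x
  have "linear (\<lambda>x. f x + inverse (Suc m) *\<^sub>R g x)" for m
    by (intro linear_compose_add linear_compose_scale_right lin)
  moreover have "inj (\<lambda>x. f x + inverse (Suc m) *\<^sub>R g x)" for m
    by (rule inj) simp
  ultimately have h: "linear (h m)" "inj (h m)" for m
    unfolding h_def by blast+
  \<comment> \<open>Uniform convergence of \<open>h m\<close> to \<open>f\<close> on a bounded set;
    stated for any body because both \<open>K\<close> and \<open>D K\<close> are needed.\<close>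
  have lim: "(\<lambda>m. hausdorff_dist (h m ` L) (f ` L)) \<longlonglongrightarrow> 0" if L: "L \<in> convex_bodies" for L
  proof -
    have "bounded (g ` L)"
      using convex_bodiesD(2)[OF linear_image_convex_bodies[OF lin(2) L]] compact_imp_bounded
      by blast
    then obtain R where R: "\<And>x. x \<in> L \<Longrightarrow> norm (g x) \<le> R"
      by (auto simp: bounded_iff)
    have le: "hausdorff_dist (h m ` L) (f ` L) \<le> inverse (Suc m) * R" for m
      using convex_bodiesD(1)[OF L] R
      by (intro hausdorff_dist_image_le) (auto simp: h_def dist_norm mult_left_mono)
    have ge: "0 \<le> hausdorff_dist (h m ` L) (f ` L)" for m
      using convex_bodiesD[OF linear_image_convex_bodies[OF h(1) L]] hausdorff_dist_nonneg by blast
    have to_0: "(\<lambda>m. inverse (real (Suc m)) * R) \<longlonglongrightarrow> 0"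
      by (rule tendsto_mult_left_zero[OF LIMSEQ_inverse_real_of_nat])
    show ?thesis
      by (rule tendsto_sandwich[OF always_eventually always_eventually tendsto_const to_0])
         (simp_all only: ge le simp_thms)
  qed
  have DK: "D K \<in> convex_bodies" using D K by blast
  have hK: "h m ` K \<in> convex_bodies" "f ` K \<in> convex_bodies" for m
    using linear_image_convex_bodies K h(1) lin(1) by blast+
  have hD: "D (h m ` K) = h m ` D K" for m
    using GL_covariant_injective[OF cov(2) K h] by simp
  have "(\<lambda>m. hausdorff_dist (h m ` D K) (D (f ` K))) \<longlonglongrightarrow> 0"
    unfolding hD[symmetric] by (rule hausdorff_continuousD[OF cov(1) hK(2,1) lim[OF K]])
  moreover have "D (f ` K) \<in> convex_bodies" "f ` D K \<in> convex_bodies" "h m ` D K \<in> convex_bodies" for m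
    using D hK(2) linear_image_convex_bodies DK h(1) lin(1) by blast+
  ultimately show ?thesis
    using lim[OF DK] convex_bodiesD by (intro hausdorff_limit_unique[of "\<lambda>m. h m ` D K"]) auto
qed

lemma GL_continuous_imp_projection_covariant:
  fixes D :: "(real^'n) set \<Rightarrow> (real^'n) set"
  assumes D: "D \<in> convex_bodies \<rightarrow> convex_bodies"
    and cov: "hausdorff_continuous D" "GL_covariant D"
  shows "projection_covariant D"
  unfolding projection_covariant_def
proof clarify
  fix K S :: "(real^'n) set"
  assume K: "K \<in> convex_bodies" and S: "subspace S"
  obtain p where p: "linear p" "\<And>x. p x \<in> S" "\<And>x. x - p x \<in> orthogonal_comp S"
    using orthogonal_projection_exists[OF S] by metis
  have "p ` D K = D (p ` K)"
  \<comment> \<open>The perturbation is by the complementary projection: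
    \<open>p x + c *\<^sub>R (x - p x)\<close> is the identity on \<open>S\<close> and scales its
    orthogonal complement by \<open>c\<close>, so it is injective.\<close>
  proof (rule covariant_limit[OF D cov K p(1)])
    show lin: "linear (\<lambda>x. x - p x)"
      using p(1) by (intro linear_compose_sub linear_ident)
    fix c :: real assume "0 < c"
    have lin': "linear (\<lambda>x. p x + c *\<^sub>R (x - p x))"
      by (intro linear_compose_add linear_compose_scale_right lin p(1))
    have "x = 0" if eq: "p x + c *\<^sub>R (x - p x) = 0" for x
    proof -
      have "p x = - (c *\<^sub>R (x - p x))" using eq by (simp add: add_eq_0_iff2)
      then have "p x \<in> orthogonal_comp S"
        using p(3) subspace_orthogonal_comp[of S] by (metis subspace_mul subspace_neg)
      then have "p x = 0" using subspace_Int_orthogonal_comp[OF S p(2)] by blast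
      then show ?thesis using eq \<open>0 < c\<close> by simp
    qed
    then show "inj (\<lambda>x. p x + c *\<^sub>R (x - p x))"
      using linear_injective_0[OF lin'] by blast
  qed
  then show "orth_proj_image (D K) S = D (orth_proj_image K S)"
    using orth_proj_image_eq[OF S p(2,3)] by simp
qed

text \<open>Scaling by \<open>r = 0\<close> is singular. Perturbing by multiples of the identity
  gives the injective scalings by \<open>r + c > 0\<close>, which treats all
  \<open>r \<ge> 0\<close> at once.\<close>

lemma GL_continuous_imp_homogeneous:
  fixes D :: "(real^'n) set \<Rightarrow> (real^'n) set"
  assumes "D \<in> convex_bodies \<rightarrow> convex_bodies" "hausdorff_continuous D" "GL_covariant D"
  shows "homogeneous_deg1 D"
  unfolding homogeneous_deg1_def
proof (intro ballI allI impI)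
  fix K :: "(real^'n) set" and r :: real
  assume K: "K \<in> convex_bodies" and r: "0 \<le> r"
  have "linear (\<lambda>x::real^'n. r *\<^sub>R x)"
    by (intro linear_compose_scale_right linear_ident)
  moreover have "inj (\<lambda>x::real^'n. r *\<^sub>R x + c *\<^sub>R x)" if "0 < c" for c
    unfolding scaleR_left_distrib[symmetric] using r that by (simp add: inj_on_def)
  ultimately show "D ((\<lambda>x. r *\<^sub>R x) ` K) = (\<lambda>x. r *\<^sub>R x) ` D K"
    using covariant_limit[OF assms K _ linear_ident] by metis
qed

section \<open>Projection covariance implies continuity and linear covariance\<close>

lemma not_in_span_singleton_exists:
  assumes "CARD('n) \<ge> 2"
  obtains u :: "real^'n" where "u \<notin> span {v}"
proof -
  have "dim (span {v}) < DIM(real^'n)"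
    using dim_le_card[of "{v}" "{v}"] assms by (simp add: span_superset)
  then have "span {v} \<noteq> UNIV" by (metis dim_UNIV less_irrefl)
  then show thesis using that by blast
qed

lemma common_inner_one_exists:
  fixes v w :: "real^'n"
  assumes "v \<noteq> 0" "w \<notin> span {v}"
  obtains x where "v \<bullet> x = 1" "w \<bullet> x = 1"
proof -
  have "independent {w, v}" using assms by (simp add: independent_insert)
  then obtain f :: "real^'n \<Rightarrow> real" where f: "linear f" "f v = 1" "f w = 1"
    using linear_independent_extend[of "{w, v}" "\<lambda>_. 1::real"] by auto
  \<comment> \<open>Riesz representation: \<open>adjoint f 1\<close> is the vector representing
    \<open>f\<close>, and it serves as the common \<open>x\<close>.\<close>
  have "f y = y \<bullet> adjoint f 1" for y
    using adjoint_works[OF f(1), of y 1] by simp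
  with f that show thesis by metis
qed

section \<open>How \<open>D\<close> acts on images under linear functionals\<close>

context
  fixes D :: "(real^'n) set \<Rightarrow> (real^'n) set"
  assumes card: "CARD('n) \<ge> 2"
    and D: "D \<in> convex_bodies \<rightarrow> convex_bodies"
    and proj: "projection_covariant D"
begin

lemma D_convex_bodies: "K \<in> convex_bodies \<Longrightarrow> D K \<in> convex_bodies"
  using D by blast

text \<open>\<open>CARD('n) \<ge> 2\<close> puts lines among the admissible subspaces: their
  dimension 1 is then at most \<open>CARD('n) - 1\<close>.\<close>

lemma orth_proj_image_D_line:
  assumes "K \<in> convex_bodies" "v \<noteq> 0"
  shows "orth_proj_image (D K) (span {v}) = D (orth_proj_image K (span {v}))"
proof -
  have "dim (span {v}) = 1"
    using assms(2) dim_eq_card_independent[of "{v}"] by simp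
  then show ?thesis
    using proj assms(1) card unfolding projection_covariant_def by auto
qed

lemma inner_image_D_cong:
  assumes K: "K \<in> convex_bodies" and L: "L \<in> convex_bodies" and eq: "inner v ` K = inner v ` L"
  shows "inner v ` D K = inner v ` D L"
proof (cases "v = 0")
  case True
  then show ?thesis
    using convex_bodiesD(1)[OF D_convex_bodies] K L by auto
next
  case False
  then have "inner v ` orth_proj_image (D K) (span {v}) = inner v ` orth_proj_image (D L) (span {v})"
    using orth_proj_image_D_line K L eq by (simp add: orth_proj_image_span)
  then show ?thesis
    using False by (simp add: orth_proj_image_span image_image)
qed

text \<open>A segment on the line of \<open>x\<close> is its own projection onto that line; by
  covariance so is its value under \<open>D\<close>.\<close>

lemma D_segment_subset_span:
  assumes "s \<le> t" "x \<noteq> 0"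
  shows "D ((\<lambda>r. r *\<^sub>R x) ` {s..t}) \<subseteq> span {x}"
proof -
  have "orth_proj_image ((\<lambda>r. r *\<^sub>R x) ` {s..t}) (span {x}) = (\<lambda>r. r *\<^sub>R x) ` {s..t}"
    using assms(2) by (simp add: orth_proj_image_span image_image)
  then have "D ((\<lambda>r. r *\<^sub>R x) ` {s..t}) = orth_proj_image (D ((\<lambda>r. r *\<^sub>R x) ` {s..t})) (span {x})"
    using orth_proj_image_D_line[OF segment_convex_bodies[OF assms(1)] assms(2)] by simp
  then show ?thesis by (auto simp: orth_proj_image_def)
qed

lemma inner_image_D_eq_if_independent:
  assumes K: "K \<in> convex_bodies" and L: "L \<in> convex_bodies"
    and ind: "v \<noteq> 0" "w \<notin> span {v}" and eq: "inner v ` K = inner w ` L"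
  shows "inner v ` D K = inner w ` D L"
proof -
  obtain x where x: "v \<bullet> x = 1" "w \<bullet> x = 1" using common_inner_one_exists[OF ind] .
  obtain s t where st: "s \<le> t" "inner v ` K = {s..t}" using inner_image_interval[OF K] .
  define M where "M = (\<lambda>r. r *\<^sub>R x) ` {s..t}"
  have M: "M \<in> convex_bodies" unfolding M_def by (rule segment_convex_bodies[OF st(1)])
  have "inner v ` M = {s..t}" "inner w ` M = {s..t}" by (simp_all add: M_def image_image x)
  then have "inner v ` D K = inner v ` D M" "inner w ` D L = inner w ` D M"
    using inner_image_D_cong K L M st(2) eq by metis+
  moreover have "x \<noteq> 0" using x by auto
  then have "D M \<subseteq> span {x}" unfolding M_def using D_segment_subset_span st(1) by blast
  then have "\<And>y. y \<in> D M \<Longrightarrow> v \<bullet> y = w \<bullet> y" using x by (auto simp: span_singleton)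
  then have "inner v ` D M = inner w ` D M" by (rule image_cong[OF refl])
  ultimately show ?thesis by simp
qed

lemma inner_image_D_eq_if_nonzero:
  assumes K: "K \<in> convex_bodies" and L: "L \<in> convex_bodies"
    and nz: "v \<noteq> 0" "w \<noteq> 0" and eq: "inner v ` K = inner w ` L"
  shows "inner v ` D K = inner w ` D L"
proof (cases "w \<in> span {v}")
  case False
  then show ?thesis using inner_image_D_eq_if_independent assms by blast
next
  case True
  \<comment> \<open>For parallel \<open>v\<close> and \<open>w\<close>, a third vector
    \<open>u\<close> independent of both acts as intermediary; \<open>M\<close> is a body with the
    same image under \<open>inner u\<close>.\<close>
  obtain u :: "real^'n" where u: "u \<notin> span {v}" using not_in_span_singleton_exists[OF card] .
  have "span {w} \<subseteq> span {v}" using True by (simp add: span_minimal)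
  with u have u': "u \<notin> span {w}" by blast
  have "u \<noteq> 0" using u span_zero by metis
  obtain s t where st: "s \<le> t" "inner v ` K = {s..t}" using inner_image_interval[OF K] .
  obtain x where x: "u \<bullet> x = 1"
    using \<open>u \<noteq> 0\<close> that[of "u /\<^sub>R (u \<bullet> u)"] by simp
  define M where "M = (\<lambda>r. r *\<^sub>R x) ` {s..t}"
  have M: "M \<in> convex_bodies" unfolding M_def by (rule segment_convex_bodies[OF st(1)])
  have "inner u ` M = {s..t}" by (simp add: M_def image_image x)
  then show ?thesis
    using inner_image_D_eq_if_independent[OF K M nz(1) u]
      inner_image_D_eq_if_independent[OF L M nz(2) u'] st(2) eq by simp
qed

text \<open>\<open>{0}\<close> is a degenerate segment on every line, so \<open>D {0}\<close> lies
  in all lines through 0, and two distinct ones meet only in 0.\<close>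

lemma D_singleton_zero: "D {0} = {0}"
proof -
  have sub: "D {0} \<subseteq> span {x}" if "x \<noteq> 0" for x
    using D_segment_subset_span[of 0 0 x] that by simp
  have "D {0} \<subseteq> {0}"
  proof
    fix y assume y: "y \<in> D {0}"
    obtain x :: "real^'n" where x: "x \<notin> span {y}" using not_in_span_singleton_exists[OF card] .
    then have "x \<noteq> 0" using span_zero by metis
    then obtain c where "y = c *\<^sub>R x" using sub y by (auto simp: span_singleton)
    moreover have "c = 0"
    proof (rule ccontr)
      assume "c \<noteq> 0"
      with \<open>y = c *\<^sub>R x\<close> have "x = inverse c *\<^sub>R y" by simp
      then show False using x by (metis span_base span_mul singletonI)
    qed
    ultimately show "y \<in> {0}" by simp
  qed
  moreover have "{0} \<in> (convex_bodies :: (real^'n) set set)" by (simp add: convex_bodies_def)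
  then have "D {0} \<noteq> {}" using D_convex_bodies convex_bodiesD(1) by blast
  ultimately show ?thesis by blast
qed

text \<open>Adds the zero functional: if \<open>v\<close> or \<open>w\<close> vanishes, the common
  image is \<open>{0}\<close>, and comparison with the body \<open>{0}\<close> shows that both
  images after \<open>D\<close> are \<open>{0}\<close> too.\<close>

lemma inner_image_D_eq:
  assumes K: "K \<in> convex_bodies" and L: "L \<in> convex_bodies" and eq: "inner v ` K = inner w ` L"
  shows "inner v ` D K = inner w ` D L"
proof -
  have z: "{0} \<in> (convex_bodies :: (real^'n) set set)" by (simp add: convex_bodies_def)
  have zero: "inner u ` D M = {0}" if M: "M \<in> convex_bodies" and "inner u ` M = {0}" for u M
    using inner_image_D_cong[OF M z] that by (simp add: D_singleton_zero)
  have trivial: "inner 0 ` M = {0}" if "M \<in> convex_bodies" for M :: "(real^'n) set"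
    using convex_bodiesD(1)[OF that] by auto
  show ?thesis
    using inner_image_D_eq_if_nonzero[OF K L _ _ eq] zero[OF K] zero[OF L] trivial[OF K] trivial[OF L]
      eq by metis
qed

section \<open>Covariance under invertible matrices\<close>

lemma projection_covariant_imp_GL_covariant: "GL_covariant D"
  unfolding GL_covariant_def
proof (intro ballI allI impI)
  fix K :: "(real^'n) set" and A :: "real^'n^'n"
  assume K: "K \<in> convex_bodies"
  have AX: "(*v) A ` X \<in> convex_bodies" if "X \<in> convex_bodies" for X
    using that by (intro linear_image_convex_bodies) auto
  have inner: "inner v ` ((*v) A ` X) = inner (transpose A *v v) ` X" for v X
    by (simp add: image_image dot_lmul_matrix[symmetric])
  show "(*v) A ` D K = D ((*v) A ` K)"
  proof (rule convex_bodies_eqI)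
    show "inner v ` ((*v) A ` D K) = inner v ` D ((*v) A ` K)" for v
      using inner_image_D_eq[OF K AX[OF K], of "transpose A *v v" v] inner by simp
  qed (use AX K D_convex_bodies in blast)+
qed

section \<open>Lipschitz estimate and continuity\<close>

lemma projection_covariant_imp_Lipschitz:
  obtains C where "0 \<le> C"
    "\<And>K L. \<lbrakk>K \<in> convex_bodies; L \<in> convex_bodies\<rbrakk> \<Longrightarrow> hausdorff_dist (D K) (D L) \<le> C * hausdorff_dist K L"
proof -
  obtain i j :: 'n where ij: "i \<noteq> j"
    using card card_le_Suc0_iff_eq[of "UNIV :: 'n set"] by fastforce
  \<comment> \<open>\<open>w s t\<close> takes the values \<open>s\<close> and \<open>t\<close> at
    the two endpoints of \<open>Q\<close>.\<close>
  define w :: "real \<Rightarrow> real \<Rightarrow> real^'n" where "w s t = s *\<^sub>R axis i 1 + t *\<^sub>R axis j 1" for s t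
  define Q :: "(real^'n) set" where "Q = closed_segment (axis i 1) (axis j 1)"
  have Q: "Q \<in> convex_bodies" by (simp add: Q_def convex_bodies_def)
  have wQ: "inner (w s t) ` Q = {s..t}" if "s \<le> t" for s t
  proof -
    have lin: "linear (inner (w s t))" by (rule bounded_linear.linear[OF bounded_linear_inner_right])
    have "inner (w s t) ` Q = closed_segment (w s t \<bullet> axis i 1) (w s t \<bullet> axis j 1)"
      unfolding Q_def by (rule closed_segment_linear_image[OF lin, symmetric])
    then show ?thesis
      using ij that by (simp add: w_def inner_axis_axis inner_add_left closed_segment_eq_real_ivl)
  qed
  obtain R where R: "0 < R" "\<And>q. q \<in> D Q \<Longrightarrow> norm q \<le> R"
    using convex_bodiesD(2)[OF D_convex_bodies[OF Q]] compact_imp_bounded bounded_pos by metis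
  have one_sided: "infdist x (D L) \<le> 2 * R * hausdorff_dist K L"
    if K: "K \<in> convex_bodies" and L: "L \<in> convex_bodies" and x: "x \<in> D K" for K L x
  proof (rule infdist_le_if_widths_le)
    let ?e = "hausdorff_dist K L"
    show "0 \<le> 2 * R * ?e"
      using R(1) hausdorff_dist_nonneg[OF convex_bodiesD(2,1)[OF K]] by simp
    fix v :: "real^'n" assume v: "norm v = 1"
    have inner_le: "\<bar>v \<bullet> a - v \<bullet> b\<bar> \<le> dist a b" for a b
      using Cauchy_Schwarz_ineq2[of v "a - b"] v by (simp add: inner_diff_right dist_norm)
    obtain s t where st: "s \<le> t" "inner v ` K = {s..t}" using inner_image_interval[OF K] .
    obtain s' t' where st': "s' \<le> t'" "inner v ` L = {s'..t'}" using inner_image_interval[OF L] .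
    \<comment> \<open>A functional of norm 1 does not increase distances. The bodies are quantified
      afresh so that the claim also applies with \<open>K\<close> and \<open>L\<close>
      exchanged.\<close>
    have close: "\<exists>b\<in>{s'..t'}. \<bar>a - b\<bar> \<le> hausdorff_dist K L"
      if im: "inner v ` K = {s..t}" "inner v ` L = {s'..t'}" "a \<in> {s..t}"
        and K: "K \<in> convex_bodies" and L: "L \<in> convex_bodies" for a s t s' t' K L
    proof -
      obtain y where y: "y \<in> K" "a = v \<bullet> y" using im(1,3) by blast
      obtain z where z: "z \<in> L" "dist y z \<le> hausdorff_dist K L"
        using hausdorff_dist_witness[OF convex_bodiesD(2)[OF K] convex_bodiesD(2,1)[OF L] y(1)] .
      have "v \<bullet> z \<in> {s'..t'}" using im(2) z(1) by blast
      then show ?thesis using inner_le[of y z] y(2) z(2) by (intro bexI[of _ "v \<bullet> z"]) auto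
    qed
    have "\<exists>b\<in>{s'..t'}. \<bar>s - b\<bar> \<le> ?e" "\<exists>b\<in>{s'..t'}. \<bar>t - b\<bar> \<le> ?e"
      using close[OF st(2) st'(2) _ K L] st(1) by auto
    moreover have "\<exists>b\<in>{s..t}. \<bar>s' - b\<bar> \<le> ?e" "\<exists>b\<in>{s..t}. \<bar>t' - b\<bar> \<le> ?e"
      using close[OF st'(2) st(2) _ L K] st'(1) by (auto simp: hausdorff_dist_commute[of L])
    \<comment> \<open>A point of \<open>{s'..t'}\<close> within \<open>?e\<close> of
      \<open>s\<close> gives \<open>s' \<le> s + ?e\<close>; the other endpoint inequalities follow
      in the same way.\<close>
    ultimately have diff: "\<bar>s - s'\<bar> \<le> ?e" "\<bar>t - t'\<bar> \<le> ?e" by (auto simp: abs_le_iff)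
    have DK: "inner v ` D K = inner (w s t) ` D Q" and DL: "inner v ` D L = inner (w s' t') ` D Q"
      using inner_image_D_eq K L Q st st' wQ by metis+
    \<comment> \<open>One point \<open>q\<close> of \<open>D Q\<close> encodes both \<open>x\<close>
      and a matching \<open>z\<close> in \<open>D L\<close>: only the functional changes, from
      \<open>w s t\<close> to \<open>w s' t'\<close>.\<close>
    obtain q where q: "q \<in> D Q" "v \<bullet> x = w s t \<bullet> q" using DK x by blast
    obtain z where z: "z \<in> D L" "v \<bullet> z = w s' t' \<bullet> q" using DL q(1) by (metis imageE imageI)
    \<comment> \<open>The factor 2 counts the two endpoints, each moving by at most
      \<open>?e\<close>; together with the bound \<open>R\<close> on \<open>D Q\<close> it gives the
      constant \<open>2 * R\<close>.\<close>
    have "norm (w s t - w s' t') \<le> 2 * ?e"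
    proof -
      have "w s t - w s' t' = (s - s') *\<^sub>R axis i 1 + (t - t') *\<^sub>R axis j 1"
        by (simp add: w_def algebra_simps)
      also have "norm \<dots> \<le> \<bar>s - s'\<bar> + \<bar>t - t'\<bar>"
        by (rule order_trans[OF norm_triangle_ineq]) simp
      finally show ?thesis using diff by linarith
    qed
    moreover have "v \<bullet> x - v \<bullet> z \<le> norm (w s t - w s' t') * norm q"
      unfolding q(2) z(2) inner_diff_left[symmetric] by (rule norm_cauchy_schwarz)
    moreover have "norm (w s t - w s' t') * norm q \<le> norm (w s t - w s' t') * R"
      using R(2)[OF q(1)] by (simp add: mult_left_mono)
    ultimately have "v \<bullet> x - v \<bullet> z \<le> 2 * ?e * R"
      using R(1) by (meson mult_right_mono order_trans less_imp_le)
    then show "\<exists>z\<in>D L. v \<bullet> x \<le> v \<bullet> z + 2 * R * ?e"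
      using z(1) by (intro bexI[of _ z]) (simp_all add: mult_ac)
  qed (use convex_bodiesD[OF D_convex_bodies[OF L]] compact_imp_closed in auto)
  show thesis
  proof (rule that)
    show "0 \<le> 2 * R" using R(1) by simp
    show "hausdorff_dist (D K) (D L) \<le> 2 * R * hausdorff_dist K L"
      if K: "K \<in> convex_bodies" and L: "L \<in> convex_bodies" for K L
      using one_sided[OF K L] one_sided[OF L K, unfolded hausdorff_dist_commute[of L]]
        convex_bodiesD(1)[OF D_convex_bodies] K L
      by (intro hausdorff_dist_leI) auto
  qed
qed

lemma projection_covariant_imp_hausdorff_continuous: "hausdorff_continuous D"
  unfolding hausdorff_continuous_def
proof clarify
  fix K :: "(real^'n) set" and L :: "nat \<Rightarrow> (real^'n) set"
  assume K: "K \<in> convex_bodies" and L: "\<forall>m. L m \<in> convex_bodies"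
    and lim: "(\<lambda>m. hausdorff_dist (L m) K) \<longlonglongrightarrow> 0"
  obtain C where C: "\<And>K L. \<lbrakk>K \<in> convex_bodies; L \<in> convex_bodies\<rbrakk> \<Longrightarrow>
      hausdorff_dist (D K) (D L) \<le> C * hausdorff_dist K L"
    using projection_covariant_imp_Lipschitz by metis
  show "(\<lambda>m. hausdorff_dist (D (L m)) (D K)) \<longlonglongrightarrow> 0"
  proof (rule tendsto_sandwich)
    show "\<forall>\<^sub>F m in sequentially. 0 \<le> hausdorff_dist (D (L m)) (D K)"
      using hausdorff_dist_nonneg[OF convex_bodiesD(2,1)[OF D_convex_bodies]] L
      by (intro always_eventually) simp
    show "\<forall>\<^sub>F m in sequentially. hausdorff_dist (D (L m)) (D K) \<le> C * hausdorff_dist (L m) K"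
      using C K L by (simp add: always_eventually)
    show "(\<lambda>m. C * hausdorff_dist (L m) K) \<longlonglongrightarrow> 0"
      using tendsto_mult_right_zero[OF lim] .
  qed simp
qed

end

theorem corollary8p3:
  fixes D :: "(real^'n) set \<Rightarrow> (real^'n) set"
  assumes "CARD('n) \<ge> 2"
    and "D \<in> convex_bodies \<rightarrow> symmetric_convex_bodies"
  shows "(projection_covariant D \<longleftrightarrow> hausdorff_continuous D \<and> GL_covariant D) \<and>
         (hausdorff_continuous D \<and> GL_covariant D \<longrightarrow> homogeneous_deg1 D)"
proof -
  have "D \<in> convex_bodies \<rightarrow> convex_bodies"
    using assms(2) by (auto simp: symmetric_convex_bodies_def)
  then show ?thesis
    using projection_covariant_imp_hausdorff_continuous[OF assms(1)]
      projection_covariant_imp_GL_covariant[OF assms(1)]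
      GL_continuous_imp_projection_covariant GL_continuous_imp_homogeneous
    by blast
qed

end
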